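(* Let $x(t)=Q(y(t))$, where $y(t)$ solves $\dot y_k=v_k(Q(y))$ for all $k\in\mathcal{N}$, and let $I$ be an open time interval over which the support of $x(t)$ remains constant. Then for all $t\in I$, all $k\in\mathcal{N}$ and all $\alpha\in\operatorname{supp}(x_k(t))$, $$\dot x_{k\alpha}=\sum_{\beta\in\operatorname{supp}(x_k)}\Big[g_k^{\alpha\beta}(x_k)-\frac{1}{G_k(x_k)}g_k^{\alpha}(x_k)g_k^{\beta}(x_k)\Big]v_{k\beta}(x).$$
   Context: Setting: a finite game with players $\mathcal{N}=\{1,\dots,N\}$, finite action sets $\mathcal{A}_k$, mixed strategy spaces $\mathcal{X}_k=\Delta(\mathcal{A}_k)$, $\mathcal{X}=\prod_k\mathcal{X}_k$, payoff vectors $v_k(x)=(u_k(\alpha;x_{-k}))_{\alpha\in\mathcal{A}_k}$ (with $u_k$ the multilinear expected payoff). Each player $k$ has a penalty function $h_k$ on $\mathcal{X}_k$: continuous, $C^\infty$ on the relative interior of every face of $\mathcal{X}_k$, and strongly convex (for some $K>0$ and norm $\|\cdot\|$, $h(tx_1+(1-t)x_2)\le th(x_1)+(1-t)h(x_2)-\tfrac12Kt(1-t)\|x_1-x_2\|^2$). Its choice map is $Q_k(y_k)=\arg\max_{x_k\in\mathcal{X}_k}\{\langle y_k,x_k\rangle-h_k(x_k)\}$, and $Q=(Q_1,\dots,Q_N)$. For $x_k$ with support $\mathcal{A}_k'$, $g_k^{\alpha\beta}(x_k)$, $\alpha,\beta\in\mathcal{A}_k'$, denotes the entries of the inverse of the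 Hessian matrix (in the coordinates $x_{k\alpha}$, $\alpha\in\mathcal{A}_k'$) of the restriction of $h_k$ to the face $\Delta(\mathcal{A}_k')$ of $\mathcal{X}_k$ (this Hessian is positive-definite by strong convexity); $g_k^\alpha(x_k)=\sum_{\beta\in\mathcal{A}_k'}g_k^{\alpha\beta}(x_k)$ and $G_k(x_k)=\sum_{\alpha\in\mathcal{A}_k'}g_k^\alpha(x_k)$. *)

theory Defs
  imports "HOL-Analysis.Analysis"
begin

text \<open>Conventions. Players form a finite type 'p (so the player set N is UNIV).
All players' actions live in a common finite type 'a; player k's action set is
A k (a nonempty subset). A mixed strategy of player k is a vector in real^'a
supported in A k. Pure payoffs: u k s for a pure profile s :: 'p => 'a.\<close>

definition mstrat :: "'a set \<Rightarrow> (real^'a::finite) set" where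
  "mstrat S = {z. (\<forall>a. 0 \<le> z $ a) \<and> (\<forall>a. a \<notin> S \<longrightarrow> z $ a = 0) \<and> (\<Sum>a\<in>S. z $ a) = 1}"

text \<open>Relative interior of the face Delta(S).\<close>
definition face_relint :: "'a set \<Rightarrow> (real^'a::finite) set" where
  "face_relint S = {z \<in> mstrat S. \<forall>a\<in>S. 0 < z $ a}"

text \<open>Coordinate subspace spanned by the coordinates in S.\<close>
definition coord_subspace :: "'a set \<Rightarrow> (real^'a::finite) set" where
  "coord_subspace S = {z. \<forall>a. a \<notin> S \<longrightarrow> z $ a = 0}"

definition supp :: "real^'a::finite \<Rightarrow> 'a set" where
  "supp z = {a. z $ a \<noteq> 0}"

text \<open>Payoff vector v_k(x): multilinear expected payoff of each pure action of k
against the mixed strategies x_{-k} of the other players (0 outside A k).\<close>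
definition payvec ::
  "('p::finite \<Rightarrow> ('p \<Rightarrow> 'a) \<Rightarrow> real) \<Rightarrow> ('p \<Rightarrow> 'a::finite set)
    \<Rightarrow> ('p \<Rightarrow> real^'a) \<Rightarrow> 'p \<Rightarrow> real^'a" where
  "payvec u A x k = (\<chi> a. \<Sum>s\<in>{s \<in> PiE UNIV A. s k = a}.
       (\<Prod>j\<in>UNIV - {k}. x j $ s j) * u k s)"

text \<open>Choice map Q_k(y_k) = argmax over X_k of <y_k,x_k> - h_k(x_k).\<close>
definition choice ::
  "('p \<Rightarrow> 'a::finite set) \<Rightarrow> ('p \<Rightarrow> real^'a \<Rightarrow> real) \<Rightarrow> 'p \<Rightarrow> real^'a \<Rightarrow> real^'a" where
  "choice A h k y = (SOME z. z \<in> mstrat (A k) \<and>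
      (\<forall>z'\<in>mstrat (A k). inner y z' - h k z' \<le> inner y z - h k z))"

definition is_norm :: "(real^'a::finite \<Rightarrow> real) \<Rightarrow> bool" where
  "is_norm n \<longleftrightarrow> (\<forall>z. 0 \<le> n z) \<and> (\<forall>z. n z = 0 \<longleftrightarrow> z = 0)
     \<and> (\<forall>c z. n (c *\<^sub>R z) = \<bar>c\<bar> * n z) \<and> (\<forall>z w. n (z + w) \<le> n z + n w)"

definition strongly_convex_on :: "(real^'a::finite) set \<Rightarrow> (real^'a \<Rightarrow> real) \<Rightarrow> bool" where
  "strongly_convex_on X f \<longleftrightarrow> (\<exists>K nrm. 0 < K \<and> is_norm nrm \<and>
     (\<forall>x1\<in>X. \<forall>x2\<in>X. \<forall>t\<in>{0..1}.
        f (t *\<^sub>R x1 + (1 - t) *\<^sub>R x2)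
          \<le> t * f x1 + (1 - t) * f x2 - 1/2 * K * t * (1 - t) * (nrm (x1 - x2))\<^sup>2))"

text \<open>Iterated partial derivatives (in coordinate directions).\<close>
fun iter_partial :: "'a list \<Rightarrow> (real^'a::finite \<Rightarrow> real) \<Rightarrow> real^'a \<Rightarrow> real" where
  "iter_partial [] f = f"
| "iter_partial (a # as) f = (\<lambda>z. deriv (\<lambda>t. iter_partial as f (z + t *\<^sub>R axis a 1)) 0)"

text \<open>f, viewed as a function of the coordinates in S only, is C-infinity on W:
all iterated partial derivatives in directions from S exist and are continuous.\<close>
definition smooth_coords_on :: "'a set \<Rightarrow> (real^'a::finite) set \<Rightarrow> (real^'a \<Rightarrow> real) \<Rightarrow> bool" where
  "smooth_coords_on S W f \<longleftrightarrow> (\<forall>as\<in>lists S. continuous_on W (iter_partial as f) \<and>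
      (\<forall>a\<in>S. \<forall>z\<in>W. (\<lambda>t. iter_partial as f (z + t *\<^sub>R axis a 1)) differentiable (at 0)))"

text \<open>h is C-infinity (in the coordinates x_a, a in S) on the relative interior of the
face Delta(S): smooth on a neighbourhood of it inside the coordinate subspace of S.\<close>
definition smooth_on_face_relint :: "'a set \<Rightarrow> (real^'a::finite \<Rightarrow> real) \<Rightarrow> bool" where
  "smooth_on_face_relint S f \<longleftrightarrow>
     (\<exists>U. open U \<and> face_relint S \<subseteq> U \<and> smooth_coords_on S (U \<inter> coord_subspace S) f)"

text \<open>Hessian entries in the coordinates x_a (a in the support).\<close>
definition hess :: "(real^'a::finite \<Rightarrow> real) \<Rightarrow> real^'a \<Rightarrow> 'a \<Rightarrow> 'a \<Rightarrow> real" where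
  "hess f z a b = iter_partial [a, b] f z"

definition pos_def_on :: "'a set \<Rightarrow> ('a \<Rightarrow> 'a \<Rightarrow> real) \<Rightarrow> bool" where
  "pos_def_on S H \<longleftrightarrow> (\<forall>w. (\<exists>a\<in>S. w a \<noteq> 0) \<longrightarrow> 0 < (\<Sum>a\<in>S. \<Sum>b\<in>S. w a * H a b * w b))"

text \<open>Inverse of the S-by-S matrix H (entries outside S x S set to 0).\<close>
definition inv_on :: "'a set \<Rightarrow> ('a \<Rightarrow> 'a \<Rightarrow> real) \<Rightarrow> 'a \<Rightarrow> 'a \<Rightarrow> real" where
  "inv_on S H = (THE M. (\<forall>a b. (a \<notin> S \<or> b \<notin> S) \<longrightarrow> M a b = 0) \<and>
      (\<forall>a\<in>S. \<forall>b\<in>S. (\<Sum>c\<in>S. H a c * M c b) = (if a = b then 1 else 0)))"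

text \<open>g^{ab}(x), g^a(x), G(x) for x with support supp x.\<close>
definition gmat :: "(real^'a::finite \<Rightarrow> real) \<Rightarrow> real^'a \<Rightarrow> 'a \<Rightarrow> 'a \<Rightarrow> real" where
  "gmat f z = inv_on (supp z) (hess f z)"

definition gvec :: "(real^'a::finite \<Rightarrow> real) \<Rightarrow> real^'a \<Rightarrow> 'a \<Rightarrow> real" where
  "gvec f z a = (\<Sum>b\<in>supp z. gmat f z a b)"

definition Gsum :: "(real^'a::finite \<Rightarrow> real) \<Rightarrow> real^'a \<Rightarrow> real" where
  "Gsum f z = (\<Sum>a\<in>supp z. gvec f z a)"

end

theory Submission
  imports Defs
begin

text \<open>While the support S of x_k(t) is constant, x_k(t) maximizes \<langle>y_k, \<cdot>\<rangle> - h_k at an interior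
  point of the face \<Delta>(S), so y_k\<beta> - \<partial>_\<beta> h_k(x_k) = \<mu>(t) for all \<beta> \<in> S. Strong convexity makes
  the choice map Lipschitz, hence x_k(s) - x_k(t) = O(s - t), and linearizing the first-order
  conditions with the Hessian H of h_k (symmetric by Schwarz's theorem) gives
  H \<Delta>x = \<Delta>y - \<Delta>\<mu> 1 + o(s - t) with \<Sum>\<Delta>x = 0. The matrix g - g g^T / G inverts H on the
  tangent space of the face and kills the constant vectors, so dividing by s - t and using
  y_k' = v_k(x) yields the formula.\<close>

section \<open>Partial derivatives in coordinate directions\<close>

lemma has_real_derivative_along_axis:
  fixes g :: "real^'a::finite \<Rightarrow> real"
  assumes "\<And>q. q \<in> W \<Longrightarrow> (\<lambda>\<tau>. g (q + \<tau> *\<^sub>R axis a 1)) differentiable (at 0)"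
    and "p + u *\<^sub>R axis a 1 \<in> W"
  shows "((\<lambda>\<tau>. g (p + \<tau> *\<^sub>R axis a 1)) has_real_derivative
           iter_partial [a] g (p + u *\<^sub>R axis a 1)) (at u)"
proof -
  define q where "q = p + u *\<^sub>R axis a 1"
  have "((\<lambda>\<tau>. g (q + \<tau> *\<^sub>R axis a 1)) has_real_derivative iter_partial [a] g q) (at (u + -u))"
    using assms q_def DERIV_deriv_iff_real_differentiable by fastforce
  hence "((\<lambda>\<tau>. g (q + (\<tau> + - u) *\<^sub>R axis a 1)) has_real_derivative iter_partial [a] g q) (at u)"
    using DERIV_shift[of "\<lambda>\<tau>. g (q + \<tau> *\<^sub>R axis a 1)" _ u "-u"] by simp
  thus ?thesis unfolding q_def by (simp add: algebra_simps)
qed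

lemma MVT_deviation_bound:
  fixes \<phi> \<phi>' :: "real \<Rightarrow> real"
  assumes der: "\<And>u. \<bar>u\<bar> \<le> \<bar>r\<bar> \<Longrightarrow> (\<phi> has_real_derivative \<phi>' u) (at u)"
    and close: "\<And>u. \<bar>u\<bar> \<le> \<bar>r\<bar> \<Longrightarrow> \<bar>\<phi>' u - c\<bar> \<le> e"
  shows "\<bar>\<phi> r - \<phi> 0 - r * c\<bar> \<le> e * \<bar>r\<bar>"
proof (cases "r = 0")
  case False
  define lo hi where "lo = min 0 r" and "hi = max 0 r"
  have "lo < hi" using False unfolding lo_def hi_def by auto
  moreover have "\<And>u. lo \<le> u \<Longrightarrow> u \<le> hi \<Longrightarrow> (\<phi> has_real_derivative \<phi>' u) (at u)"
    by (rule der) (auto simp: lo_def hi_def)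
  ultimately obtain z where z: "lo < z" "z < hi" "\<phi> hi - \<phi> lo = (hi - lo) * \<phi>' z"
    using MVT2[of lo hi \<phi> \<phi>'] by blast
  have "\<phi> r - \<phi> 0 - r * c = r * (\<phi>' z - c)"
    using z(3) unfolding lo_def hi_def by (cases "r < 0") (auto simp: algebra_simps min_def max_def)
  also have "\<bar>\<dots>\<bar> \<le> \<bar>r\<bar> * e"
    using close[of z] z unfolding lo_def hi_def by (auto simp: abs_mult intro: mult_left_mono)
  finally show ?thesis by (simp add: mult.commute)
qed simp

lemma continuous_on_finite_family_at:
  fixes F :: "'b \<Rightarrow> 'c::metric_space \<Rightarrow> real"
  assumes "finite S" "\<And>a. a \<in> S \<Longrightarrow> continuous_on W (F a)" "z \<in> W" "e > 0"
  shows "\<exists>d>0. \<forall>a\<in>S. \<forall>q\<in>W. dist q z < d \<longrightarrow> \<bar>F a q - F a z\<bar> \<le> e"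
proof -
  have "\<forall>a\<in>S. eventually (\<lambda>q. \<bar>F a q - F a z\<bar> < e) (at z within W)"
  proof
    fix a assume "a \<in> S"
    hence "(F a \<longlongrightarrow> F a z) (at z within W)"
      using assms(2,3) continuous_on_def by blast
    hence "\<forall>\<epsilon>>0. eventually (\<lambda>q. dist (F a q) (F a z) < \<epsilon>) (at z within W)"
      by (simp only: tendsto_iff)
    thus "eventually (\<lambda>q. \<bar>F a q - F a z\<bar> < e) (at z within W)"
      using assms(4) by (simp add: dist_real_def)
  qed
  hence "eventually (\<lambda>q. \<forall>a\<in>S. \<bar>F a q - F a z\<bar> < e) (at z within W)"
    by (rule eventually_ball_finite[OF assms(1), where P="\<lambda>q a. \<bar>F a q - F a z\<bar> < e"])
  then obtain d where d: "d > 0" "\<forall>q\<in>W. q \<noteq> z \<and> dist q z < d \<longrightarrow> (\<forall>a\<in>S. \<bar>F a q - F a z\<bar> < e)"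
    unfolding eventually_at by blast
  show ?thesis
  proof (intro exI[of _ d] conjI ballI impI)
    fix a q assume "a \<in> S" "q \<in> W" "dist q z < d"
    thus "\<bar>F a q - F a z\<bar> \<le> e" using d(2) assms(4) by (cases "q = z") (simp, fastforce)
  qed (rule d(1))
qed

lemma coord_subspace_add: "v \<in> coord_subspace S \<Longrightarrow> w \<in> coord_subspace S \<Longrightarrow> v + w \<in> coord_subspace S"
  and coord_subspace_diff: "v \<in> coord_subspace S \<Longrightarrow> w \<in> coord_subspace S \<Longrightarrow> v - w \<in> coord_subspace S"
  and coord_subspace_scaleR: "v \<in> coord_subspace S \<Longrightarrow> c *\<^sub>R v \<in> coord_subspace S"
  and axis_in_coord_subspace: "a \<in> S \<Longrightarrow> axis a 1 \<in> coord_subspace S"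
  by (auto simp: coord_subspace_def axis_def)

definition restrict_coords :: "'a set \<Rightarrow> real^'a::finite \<Rightarrow> real^'a" where
  "restrict_coords T w = (\<chi> i. if i \<in> T then w $ i else 0)"

lemma restrict_coords_insert:
  "b \<notin> T \<Longrightarrow> restrict_coords (insert b T) w = restrict_coords T w + (w $ b) *\<^sub>R axis b 1"
  by (auto simp: restrict_coords_def vec_eq_iff axis_def)

lemma restrict_coords_id: "w \<in> coord_subspace S \<Longrightarrow> restrict_coords S w = w"
  by (auto simp: restrict_coords_def vec_eq_iff coord_subspace_def)

lemma restrict_coords_in_coord_subspace: "T \<subseteq> S \<Longrightarrow> restrict_coords T w \<in> coord_subspace S"
  by (auto simp: restrict_coords_def coord_subspace_def)

text \<open>Telescoping over the coordinates in T, one mean value step per coordinate.\<close>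
lemma coord_increment_bound:
  fixes g :: "real^'a::finite \<Rightarrow> real"
  assumes T: "finite T" "T \<subseteq> S"
    and z: "z \<in> coord_subspace S" and ball: "ball z d \<subseteq> U"
    and diff: "\<And>a q. a \<in> S \<Longrightarrow> q \<in> U \<inter> coord_subspace S \<Longrightarrow>
                  (\<lambda>\<tau>. g (q + \<tau> *\<^sub>R axis a 1)) differentiable (at 0)"
    and close: "\<And>a q. a \<in> S \<Longrightarrow> q \<in> U \<inter> coord_subspace S \<Longrightarrow> dist q z < d \<Longrightarrow>
                  \<bar>iter_partial [a] g q - iter_partial [a] g z\<bar> \<le> e"
    and w: "w \<in> coord_subspace S" "norm w < d"
  shows "\<bar>g (z + restrict_coords T w) - g z - (\<Sum>a\<in>T. w $ a * iter_partial [a] g z)\<bar>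
           \<le> real (card T) * e * norm w"
  using T
proof (induction T rule: finite_induct)
  case (insert b T)
  define p where "p = z + restrict_coords T w"
  have near: "p + u *\<^sub>R axis b 1 \<in> U \<inter> coord_subspace S \<and> dist (p + u *\<^sub>R axis b 1) z < d"
    if "\<bar>u\<bar> \<le> \<bar>w $ b\<bar>" for u
  proof -
    have "norm (restrict_coords T w + u *\<^sub>R axis b 1) \<le> norm w"
      by (rule norm_le_componentwise_cart)
        (use that insert.hyps(2) in \<open>auto simp: restrict_coords_def axis_def\<close>)
    hence "dist (p + u *\<^sub>R axis b 1) z < d"
      using w(2) by (simp add: p_def dist_norm add.assoc)
    moreover have "p + u *\<^sub>R axis b 1 \<in> coord_subspace S"
      unfolding p_def using z insert.prems restrict_coords_in_coord_subspace
      by (intro coord_subspace_add coord_subspace_scaleR axis_in_coord_subspace) auto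
    ultimately show ?thesis using ball by (auto simp: dist_commute)
  qed
  have "\<bar>g (p + (w $ b) *\<^sub>R axis b 1) - g (p + 0 *\<^sub>R axis b 1) - w $ b * iter_partial [b] g z\<bar>
          \<le> e * \<bar>w $ b\<bar>"
  proof (rule MVT_deviation_bound)
    fix u assume "\<bar>u\<bar> \<le> \<bar>w $ b\<bar>"
    with near insert.prems show "((\<lambda>u. g (p + u *\<^sub>R axis b 1)) has_real_derivative
        iter_partial [b] g (p + u *\<^sub>R axis b 1)) (at u)"
      by (intro has_real_derivative_along_axis[of "U \<inter> coord_subspace S"] diff) auto
    show "\<bar>iter_partial [b] g (p + u *\<^sub>R axis b 1) - iter_partial [b] g z\<bar> \<le> e"
      using near[OF \<open>\<bar>u\<bar> \<le> _\<close>] insert.prems by (intro close) auto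
  qed
  also have "e * \<bar>w $ b\<bar> \<le> e * norm w"
  proof (rule mult_left_mono)
    have "0 < d" using w(2) norm_ge_zero[of w] by linarith
    hence "z \<in> U" using ball by auto
    thus "0 \<le> e" using close[of b z] \<open>0 < d\<close> insert.prems z by auto
  qed (rule component_le_norm_cart)
  finally have step: "\<bar>g (p + (w $ b) *\<^sub>R axis b 1) - g p - w $ b * iter_partial [b] g z\<bar> \<le> e * norm w"
    by simp
  have IH: "\<bar>g p - g z - (\<Sum>a\<in>T. w $ a * iter_partial [a] g z)\<bar> \<le> real (card T) * e * norm w"
    using insert by (simp add: p_def)
  show ?case
    using step IH insert.hyps
    by (simp add: restrict_coords_insert p_def add.assoc algebra_simps)
qed (simp add: restrict_coords_def vec_eq_iff[symmetric] zero_vec_def[symmetric])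

lemma has_derivative_coord_partials:
  fixes g :: "real^'a::finite \<Rightarrow> real"
  assumes U: "open U" and z: "z \<in> U" "z \<in> coord_subspace S"
    and cont: "\<And>a. a \<in> S \<Longrightarrow> continuous_on (U \<inter> coord_subspace S) (iter_partial [a] g)"
    and diff: "\<And>a q. a \<in> S \<Longrightarrow> q \<in> U \<inter> coord_subspace S \<Longrightarrow>
                  (\<lambda>\<tau>. g (q + \<tau> *\<^sub>R axis a 1)) differentiable (at 0)"
  shows "(g has_derivative (\<lambda>w. \<Sum>a\<in>S. w $ a * iter_partial [a] g z)) (at z within coord_subspace S)"
  unfolding has_derivative_within_alt
proof (intro conjI allI impI)
  show "bounded_linear (\<lambda>w. \<Sum>a\<in>S. w $ a * iter_partial [a] g z)"
    by (intro bounded_linear_sum bounded_linear_mult_left[THEN bounded_linear_compose]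
        bounded_linear_vec_nth)
  fix e :: real assume e: "e > 0"
  define e' where "e' = e / (real (card S) + 1)"
  have e': "e' > 0" using e by (simp add: e'_def)
  have "\<exists>d>0. \<forall>a\<in>S. \<forall>q\<in>U \<inter> coord_subspace S. dist q z < d \<longrightarrow>
        \<bar>iter_partial [a] g q - iter_partial [a] g z\<bar> \<le> e'"
    by (rule continuous_on_finite_family_at) (use cont z e' in auto)
  then obtain d1 where d1: "d1 > 0" "\<forall>a\<in>S. \<forall>q\<in>U \<inter> coord_subspace S. dist q z < d1 \<longrightarrow>
        \<bar>iter_partial [a] g q - iter_partial [a] g z\<bar> \<le> e'"
    by blast
  obtain d0 where d0: "d0 > 0" "ball z d0 \<subseteq> U" using U z openE by blast
  define d where "d = min d0 d1"
  show "\<exists>d>0. \<forall>y\<in>coord_subspace S. norm (y - z) < d \<longrightarrow>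
     norm (g y - g z - (\<Sum>a\<in>S. (y - z) $ a * iter_partial [a] g z)) \<le> e * norm (y - z)"
  proof (intro exI[of _ d] conjI ballI impI)
    fix y assume y: "y \<in> coord_subspace S" "norm (y - z) < d"
    have w: "y - z \<in> coord_subspace S" using y(1) z(2) by (rule coord_subspace_diff)
    have "\<bar>g (z + restrict_coords S (y - z)) - g z - (\<Sum>a\<in>S. (y - z) $ a * iter_partial [a] g z)\<bar>
            \<le> real (card S) * e' * norm (y - z)"
    proof (rule coord_increment_bound[where U=U and d=d])
      show "ball z d \<subseteq> U" using d0 by (auto simp: d_def)
      show "\<bar>iter_partial [a] g q - iter_partial [a] g z\<bar> \<le> e'"
        if "a \<in> S" "q \<in> U \<inter> coord_subspace S" "dist q z < d" for a q
        using d1(2) that by (auto simp: d_def)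
    qed (simp_all add: z(2) diff w y(2))
    also have "\<dots> \<le> e * norm (y - z)"
    proof (rule mult_right_mono)
      show "real (card S) * e' \<le> e" using e by (simp add: e'_def field_simps)
    qed simp
    finally show "norm (g y - g z - (\<Sum>a\<in>S. (y - z) $ a * iter_partial [a] g z)) \<le> e * norm (y - z)"
      by (simp add: restrict_coords_id[OF w])
  qed (use d0 d1 in \<open>simp add: d_def\<close>)
qed

lemma iter_partial_Cons: "iter_partial [a] (iter_partial as f) = iter_partial (a # as) f"
  by (rule ext) simp

lemma smooth_coords_on_has_derivative:
  assumes sm: "smooth_coords_on S (U \<inter> coord_subspace S) f" and U: "open U"
    and z: "z \<in> U" "z \<in> coord_subspace S" and as: "as \<in> lists S"
  shows "(iter_partial as f has_derivative (\<lambda>w. \<Sum>a\<in>S. w $ a * iter_partial (a # as) f z))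
           (at z within coord_subspace S)"
proof (rule has_derivative_coord_partials[OF U z, of "iter_partial as f", unfolded iter_partial_Cons])
  fix a assume "a \<in> S"
  hence "a # as \<in> lists S" using as by simp
  thus "continuous_on (U \<inter> coord_subspace S) (iter_partial (a # as) f)"
    using sm unfolding smooth_coords_on_def by blast
  show "(\<lambda>\<tau>. iter_partial as f (q + \<tau> *\<^sub>R axis a 1)) differentiable (at 0)"
    if "q \<in> U \<inter> coord_subspace S" for q
    using sm as \<open>a \<in> S\<close> that unfolding smooth_coords_on_def by blast
qed

lemma mixed_difference_MVT:
  fixes f :: "real^'a::finite \<Rightarrow> real"
  assumes sm: "smooth_coords_on S W f" and c: "c \<in> S" and d: "d \<in> S" and s: "s > 0"
    and W: "\<And>u v. 0 \<le> u \<Longrightarrow> u \<le> s \<Longrightarrow> 0 \<le> v \<Longrightarrow> v \<le> s \<Longrightarrow>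
                  z + u *\<^sub>R axis c 1 + v *\<^sub>R axis d 1 \<in> W"
  obtains \<xi> \<eta> where "0 < \<xi>" "\<xi> < s" "0 < \<eta>" "\<eta> < s"
    "f (z + s *\<^sub>R axis c 1 + s *\<^sub>R axis d 1) - f (z + s *\<^sub>R axis c 1) - f (z + s *\<^sub>R axis d 1) + f z
      = s * s * iter_partial [d, c] f (z + \<xi> *\<^sub>R axis c 1 + \<eta> *\<^sub>R axis d 1)"
proof -
  let ?ec = "axis c 1 :: real^'a" and ?ed = "axis d 1 :: real^'a"
  have diff0: "\<And>q. q \<in> W \<Longrightarrow> (\<lambda>\<tau>. f (q + \<tau> *\<^sub>R ?ec)) differentiable (at 0)"
    using sm c unfolding smooth_coords_on_def by (metis iter_partial.simps(1) lists.Nil)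
  have diff1: "\<And>q. q \<in> W \<Longrightarrow> (\<lambda>\<tau>. iter_partial [c] f (q + \<tau> *\<^sub>R ?ed)) differentiable (at 0)"
    using sm c d unfolding smooth_coords_on_def by (metis lists.Cons lists.Nil)
  define \<phi> where "\<phi> u = f (z + s *\<^sub>R ?ed + u *\<^sub>R ?ec) - f (z + u *\<^sub>R ?ec)" for u
  define \<phi>' where "\<phi>' u = iter_partial [c] f (z + s *\<^sub>R ?ed + u *\<^sub>R ?ec) - iter_partial [c] f (z + u *\<^sub>R ?ec)"
    for u
  have "\<exists>\<xi>. 0 < \<xi> \<and> \<xi> < s \<and> \<phi> s - \<phi> 0 = (s - 0) * \<phi>' \<xi>"
  proof (rule MVT2[OF s])
    fix u :: real assume u: "0 \<le> u" "u \<le> s"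
    have "z + s *\<^sub>R ?ed + u *\<^sub>R ?ec \<in> W" using W[of u s] u s by (simp add: algebra_simps)
    moreover have "z + u *\<^sub>R ?ec \<in> W" using W[of u 0] u s by simp
    ultimately show "(\<phi> has_real_derivative \<phi>' u) (at u)"
      unfolding \<phi>_def[abs_def] \<phi>'_def
      by (intro DERIV_diff has_real_derivative_along_axis[of W]) (use diff0 in auto)
  qed
  then obtain \<xi> where \<xi>: "0 < \<xi>" "\<xi> < s" "\<phi> s - \<phi> 0 = s * \<phi>' \<xi>" by auto
  define \<psi> where "\<psi> v = iter_partial [c] f (z + \<xi> *\<^sub>R ?ec + v *\<^sub>R ?ed)" for v
  have "\<exists>\<eta>. 0 < \<eta> \<and> \<eta> < s \<and>
          \<psi> s - \<psi> 0 = (s - 0) * iter_partial [d, c] f (z + \<xi> *\<^sub>R ?ec + \<eta> *\<^sub>R ?ed)"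
  proof (rule MVT2[OF s])
    fix v :: real assume v: "0 \<le> v" "v \<le> s"
    have "z + \<xi> *\<^sub>R ?ec + v *\<^sub>R ?ed \<in> W" using W[of \<xi> v] v \<xi> by simp
    hence "(\<psi> has_real_derivative iter_partial [d] (iter_partial [c] f) (z + \<xi> *\<^sub>R ?ec + v *\<^sub>R ?ed)) (at v)"
      unfolding \<psi>_def by (intro has_real_derivative_along_axis[of W]) (use diff1 in auto)
    thus "(\<psi> has_real_derivative iter_partial [d, c] f (z + \<xi> *\<^sub>R ?ec + v *\<^sub>R ?ed)) (at v)"
      by (simp add: iter_partial_Cons)
  qed
  then obtain \<eta> where \<eta>: "0 < \<eta>" "\<eta> < s"
    "\<psi> s - \<psi> 0 = s * iter_partial [d, c] f (z + \<xi> *\<^sub>R ?ec + \<eta> *\<^sub>R ?ed)" by auto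
  have "\<phi>' \<xi> = \<psi> s - \<psi> 0" unfolding \<phi>'_def \<psi>_def by (simp add: algebra_simps)
  moreover have "\<phi> s - \<phi> 0 = f (z + s *\<^sub>R ?ec + s *\<^sub>R ?ed) - f (z + s *\<^sub>R ?ec) - f (z + s *\<^sub>R ?ed) + f z"
    unfolding \<phi>_def by (simp add: algebra_simps)
  ultimately show ?thesis using that \<xi> \<eta> by auto
qed

lemma mixed_difference_approx:
  fixes f :: "real^'a::finite \<Rightarrow> real"
  assumes sm: "smooth_coords_on S (U \<inter> coord_subspace S) f" and U: "open U"
    and z: "z \<in> U" "z \<in> coord_subspace S" and c: "c \<in> S" and d: "d \<in> S" and e: "e > 0"
  shows "\<exists>\<delta>>0. \<forall>s. 0 < s \<and> s < \<delta> \<longrightarrow>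
    \<bar>f (z + s *\<^sub>R axis c 1 + s *\<^sub>R axis d 1) - f (z + s *\<^sub>R axis c 1) - f (z + s *\<^sub>R axis d 1) + f z
      - s * s * iter_partial [d, c] f z\<bar> \<le> s * s * e"
proof -
  define W where "W = U \<inter> coord_subspace S"
  have "[d, c] \<in> lists S" using c d by simp
  hence "continuous_on W (iter_partial [d, c] f)"
    using sm unfolding smooth_coords_on_def W_def by blast
  then obtain \<delta>1 where \<delta>1: "\<delta>1 > 0"
    "\<And>q. q \<in> W \<Longrightarrow> dist q z < \<delta>1 \<Longrightarrow> dist (iter_partial [d, c] f q) (iter_partial [d, c] f z) < e"
    using z e unfolding continuous_on_iff W_def by blast
  obtain d0 where d0: "d0 > 0" "ball z d0 \<subseteq> U" using U z openE by blast
  have near: "z + u *\<^sub>R axis c 1 + v *\<^sub>R axis d 1 \<in> W \<and> dist (z + u *\<^sub>R axis c 1 + v *\<^sub>R axis d 1) z < \<delta>1"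
    if "0 \<le> u" "u \<le> s" "0 \<le> v" "v \<le> s" "s < min d0 \<delta>1 / 2" for u v s
  proof -
    have "dist (z + u *\<^sub>R axis c 1 + v *\<^sub>R axis d 1) z = norm (u *\<^sub>R axis c 1 + v *\<^sub>R (axis d 1::real^'a))"
      by (simp add: dist_norm algebra_simps)
    also have "\<dots> \<le> norm (u *\<^sub>R (axis c 1::real^'a)) + norm (v *\<^sub>R (axis d 1::real^'a))"
      by (rule norm_triangle_ineq)
    also have "\<dots> < min d0 \<delta>1" using that by (simp add: norm_axis_1)
    finally have "dist (z + u *\<^sub>R axis c 1 + v *\<^sub>R axis d 1) z < min d0 \<delta>1" .
    moreover have "z + u *\<^sub>R axis c 1 + v *\<^sub>R axis d 1 \<in> coord_subspace S"
      using z(2) c d by (intro coord_subspace_add coord_subspace_scaleR axis_in_coord_subspace)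
    ultimately show ?thesis using d0(2) by (auto simp: W_def dist_commute)
  qed
  show ?thesis
  proof (intro exI[of _ "min d0 \<delta>1 / 2"] conjI allI impI)
    fix s :: real assume s: "0 < s \<and> s < min d0 \<delta>1 / 2"
    obtain \<xi> \<eta> where "0 < \<xi>" "\<xi> < s" "0 < \<eta>" "\<eta> < s" and mvt:
      "f (z + s *\<^sub>R axis c 1 + s *\<^sub>R axis d 1) - f (z + s *\<^sub>R axis c 1) - f (z + s *\<^sub>R axis d 1) + f z
        = s * s * iter_partial [d, c] f (z + \<xi> *\<^sub>R axis c 1 + \<eta> *\<^sub>R axis d 1)"
      using mixed_difference_MVT[of S W f c d s z] sm c d s near W_def by blast
    hence "\<bar>iter_partial [d, c] f (z + \<xi> *\<^sub>R axis c 1 + \<eta> *\<^sub>R axis d 1) - iter_partial [d, c] f z\<bar> \<le> e"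
      using \<delta>1(2) near[of \<xi> s \<eta>] s by (force simp: dist_real_def)
    hence "s * s * \<bar>iter_partial [d, c] f (z + \<xi> *\<^sub>R axis c 1 + \<eta> *\<^sub>R axis d 1) - iter_partial [d, c] f z\<bar>
             \<le> s * s * e"
      using s by (simp add: mult_left_mono)
    thus "\<bar>f (z + s *\<^sub>R axis c 1 + s *\<^sub>R axis d 1) - f (z + s *\<^sub>R axis c 1) - f (z + s *\<^sub>R axis d 1) + f z
            - s * s * iter_partial [d, c] f z\<bar> \<le> s * s * e"
      unfolding mvt by (simp add: abs_mult right_diff_distrib[symmetric])
  qed (use d0 \<delta>1 in simp)
qed

text \<open>Schwarz's theorem: the mixed second difference is symmetric in the two directions and
  approximates both mixed partials.\<close>
lemma iter_partial_commute:
  fixes f :: "real^'a::finite \<Rightarrow> real"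
  assumes sm: "smooth_coords_on S (U \<inter> coord_subspace S) f" and U: "open U"
    and z: "z \<in> U" "z \<in> coord_subspace S" and a: "a \<in> S" and b: "b \<in> S"
  shows "iter_partial [a, b] f z = iter_partial [b, a] f z"
proof (rule ccontr)
  define p q where "p = iter_partial [a, b] f z" and "q = iter_partial [b, a] f z"
  define \<Delta> where "\<Delta> s = f (z + s *\<^sub>R axis a 1 + s *\<^sub>R axis b 1) - f (z + s *\<^sub>R axis a 1)
                         - f (z + s *\<^sub>R axis b 1) + f z" for s
  have \<Delta>_sym: "\<Delta> s = f (z + s *\<^sub>R axis b 1 + s *\<^sub>R axis a 1) - f (z + s *\<^sub>R axis b 1)
                         - f (z + s *\<^sub>R axis a 1) + f z" for s
    unfolding \<Delta>_def by (simp add: algebra_simps)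
  assume "iter_partial [a, b] f z \<noteq> iter_partial [b, a] f z"
  hence D: "\<bar>p - q\<bar> > 0" by (simp add: p_def q_def)
  obtain \<delta>1 where "\<delta>1 > 0" and \<delta>1: "\<forall>s. 0 < s \<and> s < \<delta>1 \<longrightarrow> \<bar>\<Delta> s - s * s * q\<bar> \<le> s * s * (\<bar>p - q\<bar> / 3)"
    using mixed_difference_approx[OF sm U z a b, of "\<bar>p - q\<bar> / 3"] D unfolding \<Delta>_def[symmetric] q_def
    by auto
  obtain \<delta>2 where "\<delta>2 > 0" and \<delta>2: "\<forall>s. 0 < s \<and> s < \<delta>2 \<longrightarrow> \<bar>\<Delta> s - s * s * p\<bar> \<le> s * s * (\<bar>p - q\<bar> / 3)"
    using mixed_difference_approx[OF sm U z b a, of "\<bar>p - q\<bar> / 3"] D unfolding \<Delta>_sym[symmetric] p_def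
    by auto
  define s where "s = min \<delta>1 \<delta>2 / 2"
  have s: "0 < s" "s < \<delta>1" "s < \<delta>2" using \<open>\<delta>1 > 0\<close> \<open>\<delta>2 > 0\<close> by (auto simp: s_def)
  have "s * s * \<bar>p - q\<bar> = \<bar>(\<Delta> s - s * s * q) - (\<Delta> s - s * s * p)\<bar>"
    using s(1) by (simp add: abs_mult right_diff_distrib[symmetric])
  also have "\<dots> \<le> s * s * (\<bar>p - q\<bar> / 3) + s * s * (\<bar>p - q\<bar> / 3)"
    using \<delta>1 \<delta>2 s by (meson abs_triangle_ineq4 add_mono order_trans)
  finally show False using D s(1) by (simp add: field_simps)
qed

section \<open>Norms\<close>

lemma is_normD:
  assumes "is_norm n"
  shows "n 0 = 0" "0 \<le> n z" "n (c *\<^sub>R z) = \<bar>c\<bar> * n z" "n (z + w) \<le> n z + n w"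
    "n z = 0 \<longleftrightarrow> z = 0"
  using assms unfolding is_norm_def by auto

lemma is_norm_sum_le:
  assumes "is_norm n"
  shows "n (\<Sum>i\<in>T. f i) \<le> (\<Sum>i\<in>T. n (f i))"
proof (induction T rule: infinite_finite_induct)
  case (insert x F)
  then show ?case using is_normD(4)[OF assms, of "f x" "sum f F"] by simp
qed (simp_all add: is_normD(1)[OF assms])

lemma is_norm_le_norm:
  fixes n :: "real^'a::finite \<Rightarrow> real"
  assumes "is_norm n"
  obtains B where "B \<ge> 0" "\<And>v. n v \<le> B * norm v"
proof
  define B where "B = (\<Sum>i\<in>UNIV. n (axis i 1 :: real^'a))"
  show "B \<ge> 0" unfolding B_def using is_normD(2)[OF assms] by (simp add: sum_nonneg)
  fix v :: "real^'a"
  have "n v = n (\<Sum>i\<in>UNIV. (v $ i) *\<^sub>R axis i 1)"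
    using basis_expansion[of v] by (simp add: scalar_mult_eq_scaleR)
  also have "\<dots> \<le> (\<Sum>i\<in>UNIV. n ((v $ i) *\<^sub>R axis i 1))" by (rule is_norm_sum_le[OF assms])
  also have "\<dots> = (\<Sum>i\<in>UNIV. \<bar>v $ i\<bar> * n (axis i 1))" using is_normD(3)[OF assms] by simp
  also have "\<dots> \<le> (\<Sum>i\<in>UNIV. norm v * n (axis i 1))"
    by (rule sum_mono, rule mult_right_mono) (auto simp: component_le_norm_cart is_normD(2)[OF assms])
  also have "\<dots> = B * norm v" unfolding B_def by (simp add: sum_distrib_left mult.commute)
  finally show "n v \<le> B * norm v" .
qed

text \<open>Equivalence of norms in finite dimension: the minimum of n on the compact unit sphere
  is positive.\<close>
lemma is_norm_ge_norm:
  fixes n :: "real^'a::finite \<Rightarrow> real"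
  assumes nn: "is_norm n"
  obtains m where "m > 0" "\<And>v. m * norm v \<le> n v"
proof -
  obtain B where B: "B \<ge> 0" "\<And>v. n v \<le> B * norm v" using is_norm_le_norm[OF nn] by blast
  have lip: "\<bar>n v - n w\<bar> \<le> B * norm (v - w)" for v w
  proof -
    have "n v \<le> n (v - w) + n w" using is_normD(4)[OF nn, of "v - w" w] by simp
    moreover have "n w \<le> n (w - v) + n v" using is_normD(4)[OF nn, of "w - v" v] by simp
    moreover have "n (w - v) = n (v - w)" using is_normD(3)[OF nn, of "-1" "v - w"] by simp
    ultimately show ?thesis using B(2)[of "v - w"] by linarith
  qed
  have "continuous_on (sphere 0 1) n"
    by (rule lipschitz_on_continuous_on, rule lipschitz_onI)
      (use lip B(1) in \<open>auto simp: dist_norm dist_real_def\<close>)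
  moreover have "sphere (0::real^'a) 1 \<noteq> {}"
    using norm_axis_1[of undefined] by (metis mem_sphere_0 empty_iff)
  ultimately obtain v0 where v0: "v0 \<in> sphere 0 1" "\<And>v. v \<in> sphere 0 1 \<Longrightarrow> n v0 \<le> n v"
    using continuous_attains_inf[of "sphere (0::real^'a) 1" n] compact_sphere by blast
  have "n v0 > 0"
    using v0(1) is_normD(2,5)[OF nn, of v0] by (metis less_eq_real_def mem_sphere_0 norm_zero zero_neq_one)
  moreover have "n v0 * norm v \<le> n v" for v
  proof (cases "v = 0")
    case False
    hence "n v0 \<le> n ((1 / norm v) *\<^sub>R v)" by (intro v0(2)) simp
    also have "\<dots> = n v / norm v" using is_normD(3)[OF nn] by simp
    finally show ?thesis using False by (simp add: field_simps)
  qed (simp add: is_normD(1)[OF nn])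
  ultimately show ?thesis using that by blast
qed


section \<open>Inverting a positive definite block\<close>

lemma pos_def_on_kernel_trivial:
  assumes pd: "pos_def_on S H" and k: "\<And>a. a \<in> S \<Longrightarrow> (\<Sum>c\<in>S. H a c * w c) = 0"
  shows "\<forall>a\<in>S. w a = 0"
proof (rule ccontr)
  assume "\<not> (\<forall>a\<in>S. w a = 0)"
  hence "0 < (\<Sum>a\<in>S. \<Sum>b\<in>S. w a * H a b * w b)" using pd unfolding pos_def_on_def by blast
  also have "\<dots> = (\<Sum>a\<in>S. w a * (\<Sum>b\<in>S. H a b * w b))"
    by (simp add: sum_distrib_left mult.assoc)
  also have "\<dots> = 0" using k by simp
  finally show False by simp
qed

text \<open>Extend the S-by-S block of H by the identity to an invertible matrix of type
  real^'a^'a; its inverse restricts to a right inverse of the block.\<close>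
lemma pos_def_on_right_inverse_exists:
  fixes H :: "'a::finite \<Rightarrow> 'a \<Rightarrow> real"
  assumes pd: "pos_def_on S H"
  shows "\<exists>M. (\<forall>a b. (a \<notin> S \<or> b \<notin> S) \<longrightarrow> M a b = 0) \<and>
      (\<forall>a\<in>S. \<forall>b\<in>S. (\<Sum>c\<in>S. H a c * M c b) = (if a = b then 1 else 0))"
proof -
  define A :: "real^'a^'a" where
    "A = (\<chi> i j. if i \<in> S then (if j \<in> S then H i j else 0) else (if i = j then 1 else 0))"
  have Av: "(A *v w) $ i = (if i \<in> S then (\<Sum>j\<in>S. H i j * w $ j) else w $ i)" for w i
  proof (cases "i \<in> S")
    case True
    have "(A *v w) $ i = (\<Sum>j\<in>UNIV. if j \<in> S then H i j * w $ j else 0)"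
      unfolding matrix_vector_mult_def vec_lambda_beta by (rule sum.cong) (simp_all add: A_def True)
    thus ?thesis using True by (simp add: sum.If_cases)
  next
    case False
    have "(A *v w) $ i = (\<Sum>j\<in>UNIV. if i = j then w $ j else 0)"
      unfolding matrix_vector_mult_def vec_lambda_beta by (rule sum.cong) (simp_all add: A_def False)
    thus ?thesis using False by simp
  qed
  have lin: "linear ((*v) A)" by simp
  have "inj ((*v) A)"
  proof (rule linear_injective_0[THEN iffD2, OF lin], intro allI impI)
    fix w :: "real^'a" assume w0: "A *v w = 0"
    have "\<forall>a\<in>S. w $ a = 0"
    proof (rule pos_def_on_kernel_trivial[OF pd])
      fix a assume "a \<in> S"
      thus "(\<Sum>c\<in>S. H a c * w $ c) = 0" using Av[of w a] w0 by simp
    qed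
    moreover have "\<forall>a. a \<notin> S \<longrightarrow> w $ a = 0" using w0 Av by (metis vec_eq_iff zero_index)
    ultimately show "w = 0" by (metis vec_eq_iff zero_index)
  qed
  hence "surj ((*v) A)" using linear_injective_imp_surjective[OF lin] by blast
  define v where "v b = (SOME w. A *v w = axis b 1)" for b
  have v: "A *v v b = axis b 1" for b
    unfolding v_def by (rule someI_ex) (use \<open>surj ((*v) A)\<close> in \<open>metis surjD\<close>)
  show ?thesis
  proof (intro exI[of _ "\<lambda>c b. if c \<in> S \<and> b \<in> S then v b $ c else 0"] conjI allI impI ballI)
    fix a b assume ab: "a \<in> S" "b \<in> S"
    have "(\<Sum>c\<in>S. H a c * (if c \<in> S \<and> b \<in> S then v b $ c else 0)) = (A *v v b) $ a"
      using Av ab by simp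
    also have "\<dots> = (if a = b then 1 else 0)" using v by (simp add: axis_def)
    finally show "(\<Sum>c\<in>S. H a c * (if c \<in> S \<and> b \<in> S then v b $ c else 0)) = (if a = b then 1 else 0)" .
  qed auto
qed

lemma inv_on_right_inverse:
  fixes H :: "'a::finite \<Rightarrow> 'a \<Rightarrow> real"
  assumes pd: "pos_def_on S H" and "a \<in> S" "b \<in> S"
  shows "(\<Sum>c\<in>S. H a c * inv_on S H c b) = (if a = b then 1 else 0)"
proof -
  let ?P = "\<lambda>M. (\<forall>a b. (a \<notin> S \<or> b \<notin> S) \<longrightarrow> M a b = 0) \<and>
      (\<forall>a\<in>S. \<forall>b\<in>S. (\<Sum>c\<in>S. H a c * M c b) = (if a = b then 1 else 0))"
  have "\<exists>!M. ?P M"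
  proof (rule ex_ex1I)
    fix M M' assume PM: "?P M" and PM': "?P M'"
    show "M = M'"
    proof (intro ext)
      fix c b
      show "M c b = M' c b"
      proof (cases "b \<in> S \<and> c \<in> S")
        case True
        have "\<forall>a\<in>S. M a b - M' a b = 0"
        proof (rule pos_def_on_kernel_trivial[OF pd])
          fix a assume "a \<in> S"
          thus "(\<Sum>c\<in>S. H a c * (M c b - M' c b)) = 0"
            using PM PM' True by (simp add: algebra_simps sum_subtractf)
        qed
        thus ?thesis using True by simp
      qed (use PM PM' in auto)
    qed
  qed (rule pos_def_on_right_inverse_exists[OF pd])
  hence "?P (inv_on S H)" unfolding inv_on_def by (rule theI')
  thus ?thesis using assms(2,3) by blast
qed

lemma inv_on_sym:
  fixes H :: "'a::finite \<Rightarrow> 'a \<Rightarrow> real"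
  assumes pd: "pos_def_on S H" and sym: "\<And>a b. a \<in> S \<Longrightarrow> b \<in> S \<Longrightarrow> H a b = H b a"
    and a: "a \<in> S" and b: "b \<in> S"
  shows "inv_on S H a b = inv_on S H b a"
proof -
  define M where "M = inv_on S H"
  have R: "\<And>a b. a \<in> S \<Longrightarrow> b \<in> S \<Longrightarrow> (\<Sum>c\<in>S. H a c * M c b) = (if a = b then 1 else 0)"
    unfolding M_def by (rule inv_on_right_inverse[OF pd])
  have "(\<Sum>c\<in>S. M c a * (\<Sum>d\<in>S. H c d * M d b)) = (\<Sum>c\<in>S. if c = b then M c a else 0)"
    by (intro sum.cong refl) (simp add: R b)
  hence "M b a = (\<Sum>c\<in>S. M c a * (\<Sum>d\<in>S. H c d * M d b))"
    using b by simp
  also have "\<dots> = (\<Sum>d\<in>S. \<Sum>c\<in>S. M c a * H c d * M d b)"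
    by (simp add: sum_distrib_left mult.assoc) (rule sum.swap)
  also have "\<dots> = (\<Sum>d\<in>S. (\<Sum>c\<in>S. H d c * M c a) * M d b)"
    unfolding sum_distrib_right by (intro sum.cong refl) (simp add: sym)
  also have "\<dots> = (\<Sum>d\<in>S. if d = a then M d b else 0)"
    by (intro sum.cong refl) (simp add: R a)
  also have "\<dots> = M a b"
    using a by simp
  finally show ?thesis unfolding M_def by simp
qed

lemma inv_on_row_sums:
  fixes H :: "'a::finite \<Rightarrow> 'a \<Rightarrow> real"
  assumes pd: "pos_def_on S H" and a: "a \<in> S"
  shows "(\<Sum>c\<in>S. H a c * (\<Sum>b\<in>S. inv_on S H c b)) = 1"
proof -
  have "(\<Sum>c\<in>S. H a c * (\<Sum>b\<in>S. inv_on S H c b)) = (\<Sum>b\<in>S. \<Sum>c\<in>S. H a c * inv_on S H c b)"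
    by (simp add: sum_distrib_left) (rule sum.swap)
  also have "\<dots> = (\<Sum>b\<in>S. (if a = b then 1 else 0))"
    using inv_on_right_inverse[OF pd a] by simp
  also have "\<dots> = 1" using a by simp
  finally show ?thesis .
qed

text \<open>G = 1' H^-1 1 is the value of the positive definite form at the vector H^-1 1.\<close>
lemma inv_on_total_pos:
  fixes H :: "'a::finite \<Rightarrow> 'a \<Rightarrow> real"
  assumes pd: "pos_def_on S H" and ne: "S \<noteq> {}"
  shows "0 < (\<Sum>a\<in>S. \<Sum>b\<in>S. inv_on S H a b)"
proof -
  define w where "w c = (\<Sum>b\<in>S. inv_on S H c b)" for c
  have Hw: "\<And>a. a \<in> S \<Longrightarrow> (\<Sum>c\<in>S. H a c * w c) = 1"
    unfolding w_def by (rule inv_on_row_sums[OF pd])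
  obtain a where a: "a \<in> S" using ne by blast
  have "\<exists>a\<in>S. w a \<noteq> 0"
  proof (rule ccontr)
    assume "\<not> (\<exists>a\<in>S. w a \<noteq> 0)"
    thus False using Hw[OF a] by simp
  qed
  hence "0 < (\<Sum>a\<in>S. \<Sum>b\<in>S. w a * H a b * w b)" using pd unfolding pos_def_on_def by blast
  also have "\<dots> = (\<Sum>a\<in>S. w a * (\<Sum>b\<in>S. H a b * w b))"
    by (simp add: sum_distrib_left mult.assoc)
  also have "\<dots> = (\<Sum>a\<in>S. w a)" using Hw by simp
  finally show ?thesis unfolding w_def .
qed

text \<open>The multiplier \<mu> is annihilated because the rows of the projected inverse sum to zero.\<close>
lemma projected_inverse_solves:
  fixes H :: "'a::finite \<Rightarrow> 'a \<Rightarrow> real"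
  assumes pd: "pos_def_on S H" and sym: "\<And>a b. a \<in> S \<Longrightarrow> b \<in> S \<Longrightarrow> H a b = H b a"
    and \<alpha>: "\<alpha> \<in> S" and dx0: "(\<Sum>a\<in>S. dx a) = 0"
    and eq: "\<And>b. b \<in> S \<Longrightarrow> (\<Sum>a\<in>S. dx a * H a b) = c b - \<mu>"
  defines "gv \<equiv> \<lambda>a. \<Sum>b\<in>S. inv_on S H a b"
  defines "G \<equiv> \<Sum>a\<in>S. gv a"
  shows "dx \<alpha> = (\<Sum>\<beta>\<in>S. (inv_on S H \<alpha> \<beta> - gv \<alpha> * gv \<beta> / G) * c \<beta>)"
proof -
  define M where "M = inv_on S H"
  define P where "P \<beta> = M \<alpha> \<beta> - gv \<alpha> / G * gv \<beta>" for \<beta>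
  have "G > 0" unfolding G_def gv_def using inv_on_total_pos[OF pd] \<alpha> by blast
  have P0: "(\<Sum>\<beta>\<in>S. P \<beta>) = 0"
  proof -
    have "(\<Sum>\<beta>\<in>S. P \<beta>) = gv \<alpha> - gv \<alpha> / G * G"
      unfolding P_def by (simp add: sum_subtractf sum_distrib_left gv_def G_def M_def)
    thus ?thesis using \<open>G > 0\<close> by simp
  qed
  have PH: "(\<Sum>\<beta>\<in>S. P \<beta> * H a \<beta>) = (if a = \<alpha> then 1 else 0) - gv \<alpha> / G" if a: "a \<in> S" for a
  proof -
    have "(\<Sum>\<beta>\<in>S. P \<beta> * H a \<beta>)
        = (\<Sum>\<beta>\<in>S. H a \<beta> * M \<beta> \<alpha>) - gv \<alpha> / G * (\<Sum>\<beta>\<in>S. H a \<beta> * gv \<beta>)"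
      unfolding P_def using inv_on_sym[OF pd sym \<alpha>]
      by (simp add: algebra_simps sum_subtractf sum_distrib_left M_def cong: sum.cong)
    also have "\<dots> = (if a = \<alpha> then 1 else 0) - gv \<alpha> / G"
      using inv_on_right_inverse[OF pd a \<alpha>] inv_on_row_sums[OF pd a] by (simp add: M_def gv_def)
    finally show ?thesis .
  qed
  have "(\<Sum>\<beta>\<in>S. P \<beta> * c \<beta>) = (\<Sum>\<beta>\<in>S. P \<beta> * (\<Sum>a\<in>S. dx a * H a \<beta>)) + \<mu> * (\<Sum>\<beta>\<in>S. P \<beta>)"
    by (simp add: eq algebra_simps sum_subtractf sum_distrib_left cong: sum.cong)
  also have "\<dots> = (\<Sum>a\<in>S. dx a * (\<Sum>\<beta>\<in>S. P \<beta> * H a \<beta>))"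
    using P0 by (simp add: sum_distrib_left algebra_simps) (rule sum.swap)
  also have "\<dots> = (\<Sum>a\<in>S. dx a * (if a = \<alpha> then 1 else 0)) - gv \<alpha> / G * (\<Sum>a\<in>S. dx a)"
    by (simp add: PH right_diff_distrib sum_subtractf sum_distrib_left sum_divide_distrib mult.commute
        cong: sum.cong)
  also have "\<dots> = dx \<alpha>" using \<alpha> dx0 by (simp add: if_distrib cong: if_cong)
  finally show ?thesis unfolding P_def M_def by simp
qed

section \<open>Mixed strategies and the choice map\<close>

lemma convex_mstrat: "convex (mstrat T)"
proof (rule convexI)
  fix x y :: "real^'a" and u v :: real
  assume "x \<in> mstrat T" "y \<in> mstrat T" "0 \<le> u" "0 \<le> v" "u + v = 1"
  thus "u *\<^sub>R x + v *\<^sub>R y \<in> mstrat T"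
    by (simp add: mstrat_def sum.distrib sum_distrib_left[symmetric])
qed

lemma compact_mstrat: "compact (mstrat (T :: 'a::finite set))"
  unfolding compact_eq_bounded_closed
proof
  show "closed (mstrat T)"
    unfolding mstrat_def
    by (intro closed_Collect_conj closed_Collect_all closed_Collect_imp closed_Collect_le
        closed_Collect_eq continuous_intros) simp_all
  have "z $ a \<le> 1" if z: "z \<in> mstrat T" for z a
  proof (cases "a \<in> T")
    case True
    hence "z $ a \<le> (\<Sum>c\<in>T. z $ c)" using z by (intro member_le_sum) (auto simp: mstrat_def)
    thus ?thesis using z by (simp add: mstrat_def)
  qed (use z in \<open>simp add: mstrat_def\<close>)
  hence "mstrat T \<subseteq> cbox 0 1" by (auto simp: mem_box_cart mstrat_def)
  thus "bounded (mstrat T)" using bounded_cbox bounded_subset by blast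
qed

lemma choice_maximizes:
  assumes "A k \<noteq> {}" and "continuous_on (mstrat (A k)) (h k)"
  shows "choice A h k y \<in> mstrat (A k)"
    and "\<And>z. z \<in> mstrat (A k) \<Longrightarrow> inner y z - h k z \<le> inner y (choice A h k y) - h k (choice A h k y)"
proof -
  obtain a where "a \<in> A k" using assms(1) by blast
  hence "axis a 1 \<in> mstrat (A k)" by (auto simp: mstrat_def axis_def)
  moreover have "continuous_on (mstrat (A k)) (\<lambda>z. inner y z - h k z)"
    by (intro continuous_intros assms(2))
  ultimately have "\<exists>z\<in>mstrat (A k). \<forall>z'\<in>mstrat (A k). inner y z' - h k z' \<le> inner y z - h k z"
    by (intro continuous_attains_sup compact_mstrat) blast+
  hence "\<exists>z. z \<in> mstrat (A k) \<and> (\<forall>z'\<in>mstrat (A k). inner y z' - h k z' \<le> inner y z - h k z)"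
    by blast
  hence "choice A h k y \<in> mstrat (A k) \<and> (\<forall>z'\<in>mstrat (A k). inner y z' - h k z' \<le>
           inner y (choice A h k y) - h k (choice A h k y))"
    unfolding choice_def by (rule someI_ex)
  thus "choice A h k y \<in> mstrat (A k)"
    "\<And>z. z \<in> mstrat (A k) \<Longrightarrow> inner y z - h k z \<le> inner y (choice A h k y) - h k (choice A h k y)"
    by blast+
qed

text \<open>Comparing both optimality conditions at the midpoint with the strong convexity inequality
  gives K/2 nrm(z1 - z2)^2 \<le> \<langle>y1 - y2, z1 - z2\<rangle>.\<close>
lemma strongly_convex_argmax_lipschitz:
  fixes f :: "real^'a::finite \<Rightarrow> real"
  assumes sc: "strongly_convex_on X f" and X: "convex X"
  obtains C where "C \<ge> 0" and "\<And>y1 y2 z1 z2. z1 \<in> X \<Longrightarrow> z2 \<in> X \<Longrightarrow>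
     \<forall>z\<in>X. inner y1 z - f z \<le> inner y1 z1 - f z1 \<Longrightarrow>
     \<forall>z\<in>X. inner y2 z - f z \<le> inner y2 z2 - f z2 \<Longrightarrow> norm (z1 - z2) \<le> C * norm (y1 - y2)"
proof -
  obtain K nrm where K: "0 < K" "is_norm nrm" and
    ineq: "\<forall>x1\<in>X. \<forall>x2\<in>X. \<forall>t\<in>{0..1}. f (t *\<^sub>R x1 + (1 - t) *\<^sub>R x2)
          \<le> t * f x1 + (1 - t) * f x2 - 1/2 * K * t * (1 - t) * (nrm (x1 - x2))\<^sup>2"
    using sc unfolding strongly_convex_on_def by blast
  obtain m where m: "m > 0" "\<And>v. m * norm v \<le> nrm v" using is_norm_ge_norm[OF K(2)] by blast
  define C where "C = 2 / (K * m^2)"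
  have "norm (z1 - z2) \<le> C * norm (y1 - y2)"
    if z: "z1 \<in> X" "z2 \<in> X"
      and o1: "\<forall>z\<in>X. inner y1 z - f z \<le> inner y1 z1 - f z1"
      and o2: "\<forall>z\<in>X. inner y2 z - f z \<le> inner y2 z2 - f z2" for y1 y2 z1 z2
  proof -
    define md where "md = (1/2) *\<^sub>R z1 + (1 - 1/2) *\<^sub>R z2"
    have md: "md \<in> X" using convexD[OF X z, of "1/2" "1 - 1/2"] by (simp add: md_def)
    have "(1/2::real) \<in> {0..1}" by simp
    hence "f md \<le> 1/2 * f z1 + (1 - 1/2) * f z2 - 1/2 * K * (1/2) * (1 - 1/2) * (nrm (z1 - z2))\<^sup>2"
      using ineq z unfolding md_def by blast
    hence fmd: "f md \<le> 1/2 * f z1 + 1/2 * f z2 - K/8 * (nrm (z1 - z2))\<^sup>2"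
      by simp
    have "inner y1 md - f md \<le> inner y1 z1 - f z1" "inner y2 md - f md \<le> inner y2 z2 - f z2"
      using o1 o2 md by blast+
    moreover have "inner y md = 1/2 * inner y z1 + 1/2 * inner y z2" for y
      unfolding md_def by (simp add: inner_add_right)
    ultimately have "K/2 * (nrm (z1 - z2))\<^sup>2 \<le> inner (y1 - y2) (z1 - z2)"
      using fmd by (simp add: inner_diff_left inner_diff_right)
    also have "\<dots> \<le> norm (y1 - y2) * norm (z1 - z2)" by (rule norm_cauchy_schwarz)
    finally have A1: "K/2 * (nrm (z1 - z2))\<^sup>2 \<le> norm (y1 - y2) * norm (z1 - z2)" .
    have "(m * norm (z1 - z2))\<^sup>2 \<le> (nrm (z1 - z2))\<^sup>2"
      using m by (intro power_mono) auto
    hence "K/2 * (m * norm (z1 - z2))\<^sup>2 \<le> K/2 * (nrm (z1 - z2))\<^sup>2"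
      using K(1) by simp
    hence A2: "K * m\<^sup>2 / 2 * norm (z1 - z2) * norm (z1 - z2) \<le> norm (y1 - y2) * norm (z1 - z2)"
      using A1 by (simp add: power2_eq_square algebra_simps)
    show ?thesis
    proof (cases "z1 = z2")
      case False
      hence "K * m\<^sup>2 / 2 * norm (z1 - z2) \<le> norm (y1 - y2)"
        using A2 by (simp add: mult_le_cancel_right)
      thus ?thesis using K(1) m(1) by (simp add: C_def field_simps)
    qed (use K m in \<open>simp add: C_def\<close>)
  qed
  moreover have "C \<ge> 0" using K m by (simp add: C_def)
  ultimately show ?thesis using that by blast
qed

lemma face_relint_imp_mstrat:
  assumes z: "z \<in> face_relint S" and ST: "S \<subseteq> T"
  shows "z \<in> mstrat T"
proof -
  have zS: "z \<in> mstrat S" using z by (simp add: face_relint_def)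
  have "(\<Sum>a\<in>T. z $ a) = (\<Sum>a\<in>S. z $ a)"
    by (rule sum.mono_neutral_right) (use ST zS in \<open>auto simp: mstrat_def\<close>)
  thus ?thesis using zS ST by (auto simp: mstrat_def)
qed

lemma face_relint_coord_subspace: "z \<in> face_relint S \<Longrightarrow> z \<in> coord_subspace S"
  by (simp add: face_relint_def mstrat_def coord_subspace_def)

lemma supp_face_relint: "z \<in> face_relint S \<Longrightarrow> supp z = S"
  by (force simp: face_relint_def mstrat_def supp_def)

lemma supp_mstrat_subset: "z \<in> mstrat T \<Longrightarrow> supp z \<subseteq> T"
  by (auto simp: mstrat_def supp_def)

lemma mstrat_in_face_relint_supp:
  assumes z: "z \<in> mstrat T"
  shows "z \<in> face_relint (supp z)"
proof -
  have "(\<Sum>a\<in>T. z $ a) = (\<Sum>a\<in>supp z. z $ a)"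
    by (rule sum.mono_neutral_right) (use supp_mstrat_subset[OF z] in \<open>auto simp: supp_def\<close>)
  thus ?thesis using z by (auto simp: face_relint_def mstrat_def supp_def less_le)
qed

lemma mstrat_transfer_mass:
  assumes z: "z \<in> face_relint S" and ST: "S \<subseteq> T" and a: "a \<in> S" and b: "b \<in> S" and ab: "a \<noteq> b"
    and \<tau>: "\<bar>\<tau>\<bar> \<le> z $ a" "\<bar>\<tau>\<bar> \<le> z $ b"
  shows "z + \<tau> *\<^sub>R (axis a 1 - axis b 1) \<in> mstrat T"
proof -
  have zT: "z \<in> mstrat T" by (rule face_relint_imp_mstrat[OF z ST])
  have comp: "(z + \<tau> *\<^sub>R (axis a 1 - axis b 1)) $ c
                = z $ c + (if c = a then \<tau> else 0) - (if c = b then \<tau> else 0)" for c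
    by (simp add: axis_def)
  have "a \<in> T" "b \<in> T" using a b ST by auto
  hence "(\<Sum>c\<in>T. (z + \<tau> *\<^sub>R (axis a 1 - axis b 1)) $ c) = (\<Sum>c\<in>T. z $ c)"
    unfolding comp by (simp add: sum.distrib sum_subtractf)
  hence "(\<Sum>c\<in>T. (z + \<tau> *\<^sub>R (axis a 1 - axis b 1)) $ c) = 1" using zT by (simp add: mstrat_def)
  thus ?thesis
    unfolding mstrat_def
  proof (intro CollectI conjI allI impI)
    fix c show "0 \<le> (z + \<tau> *\<^sub>R (axis a 1 - axis b 1)) $ c"
      unfolding comp using zT \<tau> ab by (auto simp: mstrat_def)
    assume "c \<notin> T"
    thus "(z + \<tau> *\<^sub>R (axis a 1 - axis b 1)) $ c = 0"
      unfolding comp using zT a b ST by (auto simp: mstrat_def)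
  qed
qed

text \<open>First-order optimality on the face: moving mass from b to a is feasible in both
  directions, so the derivative of the objective along axis a 1 - axis b 1 vanishes.\<close>
lemma argmax_equal_marginals:
  fixes f :: "real^'a::finite \<Rightarrow> real"
  assumes f': "(f has_derivative (\<lambda>w. \<Sum>c\<in>S. w $ c * iter_partial [c] f z)) (at z within coord_subspace S)"
    and ST: "S \<subseteq> T" and z: "z \<in> face_relint S"
    and opt: "\<And>z'. z' \<in> mstrat T \<Longrightarrow> inner y z' - f z' \<le> inner y z - f z"
    and a: "a \<in> S" and b: "b \<in> S"
  shows "y $ a - iter_partial [a] f z = y $ b - iter_partial [b] f z"
proof (cases "a = b")
  case False
  define w :: "real^'a" where "w = axis a 1 - axis b 1"
  define D where "D = (y $ a - y $ b) - (iter_partial [a] f z - iter_partial [b] f z)"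
  have line: "range (\<lambda>\<tau>. z + \<tau> *\<^sub>R w) \<subseteq> coord_subspace S"
    using face_relint_coord_subspace[OF z] a b
    by (auto simp: w_def intro!: coord_subspace_add coord_subspace_scaleR coord_subspace_diff
        axis_in_coord_subspace)
  have "((\<lambda>\<tau>. inner y (z + \<tau> *\<^sub>R w) - f (z + \<tau> *\<^sub>R w)) has_real_derivative D) (at 0)"
    unfolding has_field_derivative_def
  proof (rule has_derivative_eq_rhs)
    have "((\<lambda>\<tau>. z + \<tau> *\<^sub>R w) has_derivative (\<lambda>\<tau>. \<tau> *\<^sub>R w)) (at 0)"
      by (auto intro!: derivative_eq_intros)
    moreover have "(f has_derivative (\<lambda>w. \<Sum>c\<in>S. w $ c * iter_partial [c] f z))
                     (at ((\<lambda>\<tau>. z + \<tau> *\<^sub>R w) 0) within range (\<lambda>\<tau>. z + \<tau> *\<^sub>R w))"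
      using has_derivative_subset[OF f' line] by simp
    ultimately have "((f \<circ> (\<lambda>\<tau>. z + \<tau> *\<^sub>R w)) has_derivative
        ((\<lambda>w. \<Sum>c\<in>S. w $ c * iter_partial [c] f z) \<circ> (\<lambda>\<tau>. \<tau> *\<^sub>R w))) (at 0)"
      by (rule diff_chain_within)
    thus "((\<lambda>\<tau>. inner y (z + \<tau> *\<^sub>R w) - f (z + \<tau> *\<^sub>R w)) has_derivative
        (\<lambda>\<tau>. inner y (\<tau> *\<^sub>R w) - (\<Sum>c\<in>S. (\<tau> *\<^sub>R w) $ c * iter_partial [c] f z))) (at 0)"
      unfolding o_def by (auto intro!: derivative_eq_intros)
    have "(\<Sum>c\<in>S. (\<tau> *\<^sub>R w) $ c * iter_partial [c] f z)
            = (\<Sum>c\<in>S. (if c = a then \<tau> * iter_partial [a] f z else 0)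
                     - (if c = b then \<tau> * iter_partial [b] f z else 0))" for \<tau>
      using False by (intro sum.cong refl) (auto simp: w_def axis_def)
    also have "\<dots> \<tau> = \<tau> * (iter_partial [a] f z - iter_partial [b] f z)" for \<tau>
      using a b by (simp add: sum_subtractf algebra_simps)
    finally have "(\<Sum>c\<in>S. (\<tau> *\<^sub>R w) $ c * iter_partial [c] f z)
            = \<tau> * (iter_partial [a] f z - iter_partial [b] f z)" for \<tau> .
    thus "(\<lambda>\<tau>. inner y (\<tau> *\<^sub>R w) - (\<Sum>c\<in>S. (\<tau> *\<^sub>R w) $ c * iter_partial [c] f z)) = (*) D"
      by (auto simp: D_def w_def inner_diff_right inner_axis algebra_simps)
  qed
  moreover have "0 < min (z $ a) (z $ b)" using z a b by (simp add: face_relint_def)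
  moreover have "\<forall>\<tau>. \<bar>0 - \<tau>\<bar> < min (z $ a) (z $ b) \<longrightarrow>
      inner y (z + \<tau> *\<^sub>R w) - f (z + \<tau> *\<^sub>R w) \<le> inner y (z + 0 *\<^sub>R w) - f (z + 0 *\<^sub>R w)"
    using mstrat_transfer_mass[OF z ST a b False] opt unfolding w_def by simp
  ultimately have "D = 0" by (rule DERIV_local_max)
  thus ?thesis by (simp add: D_def)
qed simp

section \<open>Differentiating the choice path\<close>

lemma has_vector_derivative_local_bound:
  assumes "(F has_vector_derivative V) (at t)"
  shows "eventually (\<lambda>s. norm (F s - F t) \<le> (norm V + 1) * \<bar>s - t\<bar>) (at t)"
proof -
  obtain d where "d > 0" and
    d: "\<And>s. norm (s - t) < d \<Longrightarrow> norm (F s - F t - (s - t) *\<^sub>R V) \<le> 1 * norm (s - t)"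
    using assms unfolding has_vector_derivative_def has_derivative_at_alt by (meson zero_less_one)
  have "norm (F s - F t) \<le> (norm V + 1) * \<bar>s - t\<bar>" if "dist s t < d" for s
  proof -
    have "norm (F s - F t) \<le> norm (F s - F t - (s - t) *\<^sub>R V) + norm ((s - t) *\<^sub>R V)"
      using norm_triangle_ineq[of "F s - F t - (s - t) *\<^sub>R V" "(s - t) *\<^sub>R V"] by simp
    also have "\<dots> \<le> \<bar>s - t\<bar> + \<bar>s - t\<bar> * norm V"
      using d[of s] that by (simp add: dist_norm)
    finally show ?thesis by (simp add: algebra_simps)
  qed
  thus ?thesis using \<open>d > 0\<close> unfolding eventually_at by blast
qed

lemma has_derivative_remainder_along_path:
  fixes g :: "'b::real_normed_vector \<Rightarrow> real"
  assumes g: "(g has_derivative g') (at z within W)"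
    and \<gamma>W: "eventually (\<lambda>s. \<gamma> s \<in> W) (at t)"
    and \<gamma>L: "eventually (\<lambda>s. norm (\<gamma> s - z) \<le> L * \<bar>s - t\<bar>) (at t)"
  shows "((\<lambda>s. (g (\<gamma> s) - g z - g' (\<gamma> s - z)) / (s - t)) \<longlongrightarrow> 0) (at t)"
proof (rule tendstoI)
  fix e :: real assume e: "e > 0"
  define e' where "e' = e / (2 * (\<bar>L\<bar> + 1))"
  have e': "e' > 0" using e by (simp add: e'_def)
  obtain d where "d > 0" and
    d: "\<And>q. q \<in> W \<Longrightarrow> norm (q - z) < d \<Longrightarrow> norm (g q - g z - g' (q - z)) \<le> e' * norm (q - z)"
    using g e' unfolding has_derivative_within_alt by blast
  have near: "eventually (\<lambda>s. \<bar>s - t\<bar> < d / (\<bar>L\<bar> + 1)) (at t)"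
    using \<open>d > 0\<close> unfolding eventually_at by (auto simp: dist_real_def intro!: exI[of _ "d / (\<bar>L\<bar> + 1)"])
  show "eventually (\<lambda>s. dist ((g (\<gamma> s) - g z - g' (\<gamma> s - z)) / (s - t)) 0 < e) (at t)"
    using \<gamma>W \<gamma>L near eventually_neq_at_within[of t t UNIV]
  proof eventually_elim
    case (elim s)
    have "norm (\<gamma> s - z) \<le> \<bar>L\<bar> * \<bar>s - t\<bar>"
      using elim(2) abs_ge_self[of L] by (meson mult_right_mono abs_ge_zero order_trans)
    moreover have "\<bar>L\<bar> * \<bar>s - t\<bar> < d" using elim(3) \<open>d > 0\<close> by (simp add: field_simps)
    ultimately have "\<bar>g (\<gamma> s) - g z - g' (\<gamma> s - z)\<bar> \<le> e' * (\<bar>L\<bar> * \<bar>s - t\<bar>)"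
      using d[OF elim(1)] e' by (smt (verit) mult_left_mono real_norm_def)
    also have "\<dots> < e * \<bar>s - t\<bar>"
      using e elim(4) by (simp add: e'_def field_simps add_nonneg_pos)
    finally show ?case using elim(4) by (simp add: dist_real_def abs_divide pos_divide_less_eq)
  qed
qed

definition proj_gmat :: "(real^'a::finite \<Rightarrow> real) \<Rightarrow> real^'a \<Rightarrow> 'a \<Rightarrow> 'a \<Rightarrow> real" where
  "proj_gmat f z \<alpha> \<beta> = gmat f z \<alpha> \<beta> - gvec f z \<alpha> * gvec f z \<beta> / Gsum f z"

definition grad_remainder :: "'a set \<Rightarrow> (real^'a::finite \<Rightarrow> real) \<Rightarrow> real^'a \<Rightarrow> real^'a \<Rightarrow> 'a \<Rightarrow> real" where
  "grad_remainder S f z z' \<beta> =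
     iter_partial [\<beta>] f z' - iter_partial [\<beta>] f z - (\<Sum>a\<in>S. (z' - z) $ a * hess f z a \<beta>)"

text \<open>Subtracting the first-order conditions y_b - \<partial>_b f = \<mu> at both argmaxes gives
  H (z' - z) = (y' - y) - remainder - (\<mu>' - \<mu>) 1, which the projected inverse solves.\<close>
lemma argmax_face_increment:
  fixes f :: "real^'a::finite \<Rightarrow> real"
  assumes U: "open U" "face_relint S \<subseteq> U" and sm: "smooth_coords_on S (U \<inter> coord_subspace S) f"
    and ST: "S \<subseteq> T" and z: "z \<in> face_relint S" and z': "z' \<in> face_relint S"
    and opt: "\<And>w. w \<in> mstrat T \<Longrightarrow> inner y w - f w \<le> inner y z - f z"
    and opt': "\<And>w. w \<in> mstrat T \<Longrightarrow> inner y' w - f w \<le> inner y' z' - f z'"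
    and pd: "pos_def_on S (hess f z)" and \<alpha>: "\<alpha> \<in> S"
  shows "z' $ \<alpha> - z $ \<alpha> = (\<Sum>\<beta>\<in>S. proj_gmat f z \<alpha> \<beta> * ((y' - y) $ \<beta> - grad_remainder S f z z' \<beta>))"
proof -
  have zU: "z \<in> U" "z \<in> coord_subspace S" using z U(2) face_relint_coord_subspace by auto
  have marginal: "v $ b - iter_partial [b] f q = v $ \<alpha> - iter_partial [\<alpha>] f q"
    if "q \<in> face_relint S" "\<And>w. w \<in> mstrat T \<Longrightarrow> inner v w - f w \<le> inner v q - f q" "b \<in> S"
    for q v b
  proof (rule argmax_equal_marginals[OF _ ST that \<alpha>])
    show "(f has_derivative (\<lambda>w. \<Sum>c\<in>S. w $ c * iter_partial [c] f q)) (at q within coord_subspace S)"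
      using smooth_coords_on_has_derivative[OF sm U(1), of q "[]"] that(1) U(2)
        face_relint_coord_subspace by auto
  qed
  have dx0: "(\<Sum>a\<in>S. (z' - z) $ a) = 0"
    using z z' by (simp add: face_relint_def mstrat_def sum_subtractf)
  have linearized: "(\<Sum>a\<in>S. (z' - z) $ a * hess f z a \<beta>) = ((y' - y) $ \<beta> - grad_remainder S f z z' \<beta>)
      - ((y' $ \<alpha> - iter_partial [\<alpha>] f z') - (y $ \<alpha> - iter_partial [\<alpha>] f z))"
    if "\<beta> \<in> S" for \<beta>
    using marginal[OF z' opt' that] marginal[OF z opt that] by (simp add: grad_remainder_def)
  have sym: "\<And>a b. a \<in> S \<Longrightarrow> b \<in> S \<Longrightarrow> hess f z a b = hess f z b a"
    unfolding hess_def using iter_partial_commute[OF sm U(1) zU] by blast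
  from projected_inverse_solves[OF pd sym \<alpha> dx0 linearized]
  show ?thesis using supp_face_relint[OF z] by (simp add: proj_gmat_def gmat_def gvec_def Gsum_def)
qed

lemma grad_remainder_tendsto_0:
  fixes f :: "real^'a::finite \<Rightarrow> real" and X :: "real \<Rightarrow> real^'a"
  assumes U: "open U" "face_relint S \<subseteq> U" and sm: "smooth_coords_on S (U \<inter> coord_subspace S) f"
    and face: "eventually (\<lambda>s. X s \<in> face_relint S) (at t)" "X t \<in> face_relint S"
    and lip: "eventually (\<lambda>s. norm (X s - X t) \<le> L * \<bar>s - t\<bar>) (at t)"
    and \<beta>: "\<beta> \<in> S"
  shows "((\<lambda>s. grad_remainder S f (X t) (X s) \<beta> / (s - t)) \<longlongrightarrow> 0) (at t)"
proof -
  have "X t \<in> U" "X t \<in> coord_subspace S" using face(2) U(2) face_relint_coord_subspace by auto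
  note f' = smooth_coords_on_has_derivative[OF sm U(1) this, of "[\<beta>]"]
  have "eventually (\<lambda>s. X s \<in> coord_subspace S) (at t)"
    using face(1) by eventually_elim (rule face_relint_coord_subspace)
  thus ?thesis
    using has_derivative_remainder_along_path[OF f' _ lip] \<beta>
    by (simp add: grad_remainder_def hess_def)
qed

lemma argmax_path_component_derivative:
  fixes f :: "real^'a::finite \<Rightarrow> real" and X Y :: "real \<Rightarrow> real^'a"
  assumes U: "open U" "face_relint S \<subseteq> U" and sm: "smooth_coords_on S (U \<inter> coord_subspace S) f"
    and ST: "S \<subseteq> T" and I: "open I" "t \<in> I"
    and face: "\<And>s. s \<in> I \<Longrightarrow> X s \<in> face_relint S"
    and opt: "\<And>s z. s \<in> I \<Longrightarrow> z \<in> mstrat T \<Longrightarrow> inner (Y s) z - f z \<le> inner (Y s) (X s) - f (X s)"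
    and lip: "C \<ge> 0" "\<And>s. s \<in> I \<Longrightarrow> norm (X s - X t) \<le> C * norm (Y s - Y t)"
    and pd: "pos_def_on S (hess f (X t))"
    and Y': "(Y has_vector_derivative V) (at t)"
    and \<alpha>: "\<alpha> \<in> S"
  shows "((\<lambda>s. X s $ \<alpha>) has_real_derivative (\<Sum>\<beta>\<in>S. proj_gmat f (X t) \<alpha> \<beta> * V $ \<beta>)) (at t)"
proof -
  define P where "P = proj_gmat f (X t) \<alpha>"
  define r where "r \<beta> s = grad_remainder S f (X t) (X s) \<beta>" for \<beta> s
  have "((\<lambda>s. (Y s $ \<beta> - Y t $ \<beta>) / (s - t)) \<longlongrightarrow> V $ \<beta>) (at t)" for \<beta>
    using bounded_linear.has_vector_derivative[OF bounded_linear_vec_nth Y', of \<beta>]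
    by (simp add: has_real_derivative_iff_has_vector_derivative[symmetric] has_field_derivative_iff)
  moreover have "((\<lambda>s. r \<beta> s / (s - t)) \<longlongrightarrow> 0) (at t)" if "\<beta> \<in> S" for \<beta>
    unfolding r_def
  proof (rule grad_remainder_tendsto_0[where X = X and t = t, OF U sm _ face[OF I(2)] _ that])
    show "eventually (\<lambda>s. X s \<in> face_relint S) (at t)"
      using eventually_at_in_open'[OF I] by eventually_elim (rule face)
    show "eventually (\<lambda>s. norm (X s - X t) \<le> C * (norm V + 1) * \<bar>s - t\<bar>) (at t)"
      using has_vector_derivative_local_bound[OF Y'] eventually_at_in_open'[OF I]
    proof eventually_elim
      case (elim s)
      thus ?case using lip(2)[of s] mult_left_mono[OF elim(1) lip(1)] by (simp add: mult.assoc)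
    qed
  qed
  ultimately have "((\<lambda>s. \<Sum>\<beta>\<in>S. P \<beta> * ((Y s $ \<beta> - Y t $ \<beta>) / (s - t) - r \<beta> s / (s - t)))
                     \<longlongrightarrow> (\<Sum>\<beta>\<in>S. P \<beta> * (V $ \<beta> - 0))) (at t)"
    by (intro tendsto_intros) auto
  moreover have "eventually (\<lambda>s. (\<Sum>\<beta>\<in>S. P \<beta> * ((Y s $ \<beta> - Y t $ \<beta>) / (s - t) - r \<beta> s / (s - t)))
                     = (X s $ \<alpha> - X t $ \<alpha>) / (s - t)) (at t)"
    using eventually_at_in_open'[OF I]
  proof eventually_elim
    case (elim s)
    have "X s $ \<alpha> - X t $ \<alpha> = (\<Sum>\<beta>\<in>S. P \<beta> * ((Y s - Y t) $ \<beta> - r \<beta> s))"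
      unfolding P_def r_def
      by (rule argmax_face_increment[OF U sm ST face[OF I(2)] face[OF elim] opt[OF I(2)] opt[OF elim] pd \<alpha>])
    hence "(X s $ \<alpha> - X t $ \<alpha>) / (s - t) = (\<Sum>\<beta>\<in>S. P \<beta> * ((Y s - Y t) $ \<beta> - r \<beta> s) / (s - t))"
      by (simp add: sum_divide_distrib)
    also have "\<dots> = (\<Sum>\<beta>\<in>S. P \<beta> * ((Y s $ \<beta> - Y t $ \<beta>) / (s - t) - r \<beta> s / (s - t)))"
      by (intro sum.cong refl) (simp add: diff_divide_distrib[symmetric])
    finally show ?case ..
  qed
  ultimately have "((\<lambda>s. (X s $ \<alpha> - X t $ \<alpha>) / (s - t)) \<longlongrightarrow> (\<Sum>\<beta>\<in>S. P \<beta> * V $ \<beta>)) (at t)"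
    using tendsto_cong by fastforce
  thus ?thesis unfolding has_field_derivative_iff P_def .
qed

theorem proposition3p2:
  fixes A :: "'p::finite \<Rightarrow> 'a::finite set"
    and u :: "'p \<Rightarrow> ('p \<Rightarrow> 'a) \<Rightarrow> real"
    and h :: "'p \<Rightarrow> real^'a \<Rightarrow> real"
    and y :: "real \<Rightarrow> 'p \<Rightarrow> real^'a"
    and x :: "real \<Rightarrow> 'p \<Rightarrow> real^'a"
    and I :: "real set"
  assumes A_ne: "\<And>k. A k \<noteq> {}"
    and h_cont: "\<And>k. continuous_on (mstrat (A k)) (h k)"
    and h_smooth: "\<And>k S. S \<subseteq> A k \<Longrightarrow> S \<noteq> {} \<Longrightarrow> smooth_on_face_relint S (h k)"
    and h_sconv: "\<And>k. strongly_convex_on (mstrat (A k)) (h k)"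
    and h_hess_pd: "\<And>k S z. S \<subseteq> A k \<Longrightarrow> S \<noteq> {} \<Longrightarrow> z \<in> face_relint S \<Longrightarrow>
                       pos_def_on S (hess (h k) z)"
    and x_def: "\<And>t k. x t k = choice A h k (y t k)"
    and I_open: "open I" and I_interval: "is_interval I"
    and y_sol: "\<And>t k. t \<in> I \<Longrightarrow>
                 ((\<lambda>s. y s k) has_vector_derivative payvec u A (x t) k) (at t)"
    and supp_const: "\<And>t s k. t \<in> I \<Longrightarrow> s \<in> I \<Longrightarrow> supp (x t k) = supp (x s k)"
  shows "\<forall>t\<in>I. \<forall>k. \<forall>\<alpha>\<in>supp (x t k).
           ((\<lambda>s. x s k $ \<alpha>) has_real_derivative
              (\<Sum>\<beta>\<in>supp (x t k).
                 (gmat (h k) (x t k) \<alpha> \<beta>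
                   - gvec (h k) (x t k) \<alpha> * gvec (h k) (x t k) \<beta> / Gsum (h k) (x t k))
                 * payvec u A (x t) k $ \<beta>)) (at t)"
proof (intro ballI allI)
  fix t k \<alpha> assume t: "t \<in> I" and \<alpha>: "\<alpha> \<in> supp (x t k)"
  define S where "S = supp (x t k)"
  have x_mstrat: "x s k \<in> mstrat (A k)" for s
    unfolding x_def by (rule choice_maximizes(1)[of A k h, OF A_ne h_cont])
  have x_opt: "inner (y s k) z - h k z \<le> inner (y s k) (x s k) - h k (x s k)" if "z \<in> mstrat (A k)" for s z
    unfolding x_def by (rule choice_maximizes(2)[of A k h, OF A_ne h_cont that])
  have S: "S \<subseteq> A k" "S \<noteq> {}" using supp_mstrat_subset[OF x_mstrat] \<alpha> by (auto simp: S_def)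
  have face: "x s k \<in> face_relint S" if "s \<in> I" for s
    using mstrat_in_face_relint_supp[OF x_mstrat, of s] supp_const[OF that t, of k] by (simp add: S_def)
  obtain U where U: "open U" "face_relint S \<subseteq> U" "smooth_coords_on S (U \<inter> coord_subspace S) (h k)"
    using h_smooth[OF S] unfolding smooth_on_face_relint_def by blast
  obtain C where "C \<ge> 0" and lip: "\<And>s. norm (x s k - x t k) \<le> C * norm (y s k - y t k)"
    using strongly_convex_argmax_lipschitz[OF h_sconv convex_mstrat] x_mstrat x_opt by metis
  have "((\<lambda>s. x s k $ \<alpha>) has_real_derivative
          (\<Sum>\<beta>\<in>S. proj_gmat (h k) (x t k) \<alpha> \<beta> * payvec u A (x t) k $ \<beta>)) (at t)"
  proof (rule argmax_path_component_derivative[where X = "\<lambda>s. x s k" and Y = "\<lambda>s. y s k"])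
    show "pos_def_on S (hess (h k) (x t k))" using h_hess_pd[OF S face[OF t]] .
  qed (use U S face x_opt lip \<open>C \<ge> 0\<close> I_open t y_sol \<alpha> in \<open>auto simp: S_def\<close>)
  thus "((\<lambda>s. x s k $ \<alpha>) has_real_derivative
          (\<Sum>\<beta>\<in>supp (x t k). (gmat (h k) (x t k) \<alpha> \<beta>
             - gvec (h k) (x t k) \<alpha> * gvec (h k) (x t k) \<beta> / Gsum (h k) (x t k))
           * payvec u A (x t) k $ \<beta>)) (at t)"
    by (simp add: S_def proj_gmat_def)
qed

end
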